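(* $\Theta(\hat E)$ and $\mathcal{ERT}_0(\hat E)$ form an exact sequence, i.e. $$\operatorname{curl}\Theta(\hat E)=\{p\in\mathcal{ERT}_0(\hat E):\operatorname{div}p=0\}.$$
   Context: All spaces consist of vector polynomials in $\hat{\mathbf x}=(\hat x,\hat y,\hat z)^T$ on the reference cube $\hat E=[0,1]^3$. **Space $\mathcal{ERT}_0(\hat E)$.** $\mathcal{RT}_0(\hat E)=\{(\alpha_1+\beta_1\hat x,\alpha_2+\beta_2\hat y,\alpha_3+\beta_3\hat z)^T:\alpha_i,\beta_i\in\mathbb{R}\}$. $\mathcal B(\hat E)$ is the span of the vectors $(b,0,0)^T$ with $b\in\{\hat y,\hat z,\hat x\hat y,\hat x\hat z,\hat y\hat z,\hat x\hat y\hat z\}$, $(0,b,0)^T$ with $b\in\{\hat x,\hat z,\hat x\hat y,\hat x\hat z,\hat y\hat z,\hat x\hat y\hat z\}$, and $(0,0,b)^T$ with $b\in\{\hat x,\hat y,\hat x\hat y,\hat x\hat z,\hat y\hat z,\hat x\hat y\hat z\}$. Then $\mathcal{ERT}_0(\hat E)=\mathcal{RT}_0(\hat E)+\operatorname{curl}(\hat{\mathbf x}\times\mathcal B(\hat E))$, with $\times$ the cross product. **Space $\Theta(\hat E)$.** $\Theta(\hat E)$ is spanned by: $(p,0,0)^T$ with $p\in\{1,\hat x,\hat y,\hat z,\hat x\hat y,\hat x\hat z,\hat y\hat z,\hat x\hat y\hat z,\hat y^2,\hat z^2,\hat x\hat y^2,\hat x\hat z^2,\hat y^2\hat z,\hat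 y\hat z^2\}$; $(0,p,0)^T$ with $p\in\{1,\hat x,\hat y,\hat z,\hat x\hat y,\hat x\hat z,\hat y\hat z,\hat x\hat y\hat z,\hat x^2,\hat z^2,\hat x^2\hat y,\hat y\hat z^2,\hat x^2\hat z,\hat x\hat z^2\}$; $(0,0,p)^T$ with $p\in\{1,\hat x,\hat y,\hat z,\hat x\hat y,\hat x\hat z,\hat y\hat z,\hat x\hat y\hat z,\hat x^2,\hat y^2,\hat x^2\hat z,\hat y^2\hat z,\hat x^2\hat y,\hat x\hat y^2\}$; and the six vectors $(0,\hat x\hat y\hat z^2,-\hat x\hat y^2\hat z)^T$, $(-\hat x\hat y\hat z^2,0,\hat x^2\hat y\hat z)^T$, $(\hat x\hat y^2\hat z,-\hat x^2\hat y\hat z,0)^T$, $(2\hat x\hat y^2\hat z,2\hat x^2\hat y\hat z,\hat x^2\hat y^2)^T$, $(2\hat x\hat y\hat z^2,\hat x^2\hat z^2,2\hat x^2\hat y\hat z)^T$, $(\hat y^2\hat z^2,2\hat x\hat y\hat z^2,2\hat x\hat y^2\hat z)^T$. *)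

theory Defs
  imports "HOL-Analysis.Analysis" "HOL-Library.Function_Algebras"
begin

text \<open>Pointwise scalar multiplication, which makes vector fields a real vector space, so that the
  library's \<open>span\<close> applies to sets of fields. The other operations come from
  \<open>Function_Algebras\<close>.\<close>

instantiation "fun" :: (type, real_vector) real_vector
begin

definition scaleR_fun_def: "scaleR c f = (\<lambda>x. c *\<^sub>R f x)"

instance
  by standard (auto simp: scaleR_fun_def plus_fun_def fun_eq_iff algebra_simps)

end

text \<open>Polynomials on the reference cube are represented by the polynomial functions on the whole
  of \<open>real ^ 3\<close>. Nothing is lost: a polynomial is determined by its values on
  the unit cube, and the same holds for its partial derivatives. The ring operations and numerals
  in expressions such as \<open>2 * X * Y^2 * Z\<close> are the pointwise ones on functions.\<close>

type_synonym scalar_field = "real ^ 3 \<Rightarrow> real"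
type_synonym vector_field = "real ^ 3 \<Rightarrow> real ^ 3"

definition X :: scalar_field where "X v = v $ 1"
definition Y :: scalar_field where "Y v = v $ 2"
definition Z :: scalar_field where "Z v = v $ 3"

definition vec_field :: "scalar_field \<Rightarrow> scalar_field \<Rightarrow> scalar_field \<Rightarrow> vector_field" where
  "vec_field p q r = (\<lambda>v. vector [p v, q v, r v])"

text \<open>The entry \<open>jacobian F (at v) $ i $ j\<close> is the partial derivative of the \<open>i\<close>-th component
  of \<open>F\<close> in the \<open>j\<close>-th coordinate.\<close>

definition curl :: "vector_field \<Rightarrow> vector_field" where
  "curl F = (\<lambda>v. let J = jacobian F (at v) in
     vector [J $ 3 $ 2 - J $ 2 $ 3, J $ 1 $ 3 - J $ 3 $ 1, J $ 2 $ 1 - J $ 1 $ 2])"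

definition divergence :: "vector_field \<Rightarrow> scalar_field" where
  "divergence F = (\<lambda>v. let J = jacobian F (at v) in J $ 1 $ 1 + J $ 2 $ 2 + J $ 3 $ 3)"

definition RT0 :: "vector_field set" where
  "RT0 = {(\<lambda>v. vector [\<alpha>\<^sub>1 + \<beta>\<^sub>1 * v $ 1, \<alpha>\<^sub>2 + \<beta>\<^sub>2 * v $ 2, \<alpha>\<^sub>3 + \<beta>\<^sub>3 * v $ 3]) |
            \<alpha>\<^sub>1 \<alpha>\<^sub>2 \<alpha>\<^sub>3 \<beta>\<^sub>1 \<beta>\<^sub>2 \<beta>\<^sub>3. True}"

definition B_space :: "vector_field set" where
  "B_space = span
     ((\<lambda>b. vec_field b 0 0) ` {Y, Z, X * Y, X * Z, Y * Z, X * Y * Z} \<union>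
      (\<lambda>b. vec_field 0 b 0) ` {X, Z, X * Y, X * Z, Y * Z, X * Y * Z} \<union>
      (\<lambda>b. vec_field 0 0 b) ` {X, Y, X * Y, X * Z, Y * Z, X * Y * Z})"

definition ERT0 :: "vector_field set" where
  "ERT0 = {r + curl (\<lambda>v. cross3 v (b v)) | r b. r \<in> RT0 \<and> b \<in> B_space}"

definition Theta :: "vector_field set" where
  "Theta = span
     ((\<lambda>p. vec_field p 0 0) `
        {1, X, Y, Z, X * Y, X * Z, Y * Z, X * Y * Z,
         Y^2, Z^2, X * Y^2, X * Z^2, Y^2 * Z, Y * Z^2} \<union>
      (\<lambda>p. vec_field 0 p 0) `
        {1, X, Y, Z, X * Y, X * Z, Y * Z, X * Y * Z,
         X^2, Z^2, X^2 * Y, Y * Z^2, X^2 * Z, X * Z^2} \<union>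
      (\<lambda>p. vec_field 0 0 p) `
        {1, X, Y, Z, X * Y, X * Z, Y * Z, X * Y * Z,
         X^2, Y^2, X^2 * Z, Y^2 * Z, X^2 * Y, X * Y^2} \<union>
      {vec_field 0 (X * Y * Z^2) (- (X * Y^2 * Z)),
       vec_field (- (X * Y * Z^2)) 0 (X^2 * Y * Z),
       vec_field (X * Y^2 * Z) (- (X^2 * Y * Z)) 0,
       vec_field (2 * X * Y^2 * Z) (2 * X^2 * Y * Z) (X^2 * Y^2),
       vec_field (2 * X * Y * Z^2) (X^2 * Z^2) (2 * X^2 * Y * Z),
       vec_field (Y^2 * Z^2) (2 * X * Y * Z^2) (2 * X * Y^2 * Z)})"

end

theory Submission
  imports Defs
begin

text \<open>The Poincare potential of a divergence-free field is, up to a factor on each homogeneous part,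
  its cross product with the position vector. The space \<open>Theta\<close> contains \<open>x \<times> B\<close> and potentials of
  the divergence-free fields in \<open>RT0\<close>, so every divergence-free element of \<open>ERT0\<close> is a curl. In the
  other direction the last three generators of \<open>Theta\<close> are gradients, and the curl of every other
  generator lies in \<open>RT0\<close> or is a combination of at most two fields \<open>curl (x \<times> b)\<close> with \<open>b\<close> a
  generator of \<open>B_space\<close>.\<close>

subsection \<open>Partial derivatives\<close>

text \<open>Differentiability on the whole space, for scalar and vector fields alike. With it as
  side condition, the rules for \<open>partial\<close>, \<open>curl\<close> and
  \<open>divergence\<close> are equations between functions, and simplification differentiates
  polynomials symbolically.\<close>

definition pdiff :: "(real ^ 3 \<Rightarrow> 'b::real_normed_vector) \<Rightarrow> bool" where
  "pdiff p \<longleftrightarrow> (\<forall>v. p differentiable at v)"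

definition partial :: "3 \<Rightarrow> scalar_field \<Rightarrow> scalar_field" where
  "partial i p = (\<lambda>v. frechet_derivative p (at v) (axis i 1))"

lemmas fun_ops = plus_fun_def fun_diff_def fun_Compl_def times_fun_def scaleR_fun_def
  zero_fun_def one_fun_def numeral_fun

lemma has_derivative_partial:
  assumes "(p has_derivative D) (at v)"
  shows "partial i p v = D (axis i 1)"
  using frechet_derivative_at[OF assms] by (simp add: partial_def)

lemma pdiff_has_derivative:
  assumes "pdiff p"
  shows "(p has_derivative frechet_derivative p (at v)) (at v)"
  using assms by (simp add: pdiff_def frechet_derivative_works)

lemma pdiff_const [simp]: "pdiff 0" "pdiff (1 :: scalar_field)" "pdiff (numeral n :: scalar_field)"
  by (simp_all add: pdiff_def fun_ops)

lemma pdiff_add [simp]: "pdiff p \<Longrightarrow> pdiff q \<Longrightarrow> pdiff (p + q)"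
  and pdiff_diff [simp]: "pdiff p \<Longrightarrow> pdiff q \<Longrightarrow> pdiff (p - q)"
  and pdiff_minus [simp]: "pdiff p \<Longrightarrow> pdiff (- p)"
  and pdiff_scaleR [simp]: "pdiff p \<Longrightarrow> pdiff (c *\<^sub>R p)"
  by (simp_all add: pdiff_def fun_ops)

lemma pdiff_mult [simp]: "pdiff p \<Longrightarrow> pdiff q \<Longrightarrow> pdiff (p * q :: scalar_field)"
  by (simp add: pdiff_def fun_ops)

lemma pdiff_power2 [simp]: "pdiff p \<Longrightarrow> pdiff (p\<^sup>2 :: scalar_field)"
  by (simp add: power2_eq_square)

lemma has_derivative_coord: "((\<lambda>v. v $ i) has_derivative (\<lambda>v. v $ i)) (at (v :: real ^ 'n))"
  by (rule bounded_linear_imp_has_derivative[OF bounded_linear_vec_nth])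

lemma coord_eq: "X = (\<lambda>v. v $ 1)" "Y = (\<lambda>v. v $ 2)" "Z = (\<lambda>v. v $ 3)"
  by (simp_all add: fun_eq_iff X_def Y_def Z_def)

lemma pdiff_coord [simp]: "pdiff X" "pdiff Y" "pdiff Z"
  unfolding pdiff_def coord_eq differentiable_def using has_derivative_coord by blast+

lemma partial_const [simp]: "partial i 0 = 0" "partial i 1 = 0" "partial i (numeral n) = 0"
  by (simp_all add: partial_def fun_ops)

lemma partial_coord [simp]:
  "partial 1 X = 1" "partial 2 X = 0" "partial 3 X = 0"
  "partial 1 Y = 0" "partial 2 Y = 1" "partial 3 Y = 0"
  "partial 1 Z = 0" "partial 2 Z = 0" "partial 3 Z = 1"
  by (simp_all add: fun_eq_iff coord_eq has_derivative_partial[OF has_derivative_coord] axis_def)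

lemma partial_add [simp]:
  assumes "pdiff p" "pdiff q"
  shows "partial i (p + q) = partial i p + partial i q"
proof
  fix v show "partial i (p + q) v = (partial i p + partial i q) v"
    using has_derivative_partial[OF has_derivative_add[OF assms[THEN pdiff_has_derivative]], of i v]
    by (simp add: plus_fun_def partial_def)
qed

lemma partial_scaleR [simp]:
  assumes "pdiff p"
  shows "partial i (c *\<^sub>R p) = c *\<^sub>R partial i p"
proof
  fix v show "partial i (c *\<^sub>R p) v = (c *\<^sub>R partial i p) v"
    using has_derivative_partial[OF has_derivative_scaleR_right[OF assms[THEN pdiff_has_derivative]], of i c v]
    by (simp add: scaleR_fun_def partial_def)
qed

lemma partial_minus [simp]: "pdiff p \<Longrightarrow> partial i (- p) = - partial i p"
  using partial_scaleR[of p i "-1"] by simp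

lemma partial_diff [simp]:
  "pdiff p \<Longrightarrow> pdiff q \<Longrightarrow> partial i (p - q) = partial i p - partial i q"
  using partial_add[of p "- q" i] by simp

lemma partial_mult [simp]:
  assumes "pdiff p" "pdiff q"
  shows "partial i (p * q) = p * partial i q + partial i p * q"
proof
  fix v show "partial i (p * q) v = (p * partial i q + partial i p * q) v"
    using has_derivative_partial[OF has_derivative_mult[OF assms[THEN pdiff_has_derivative]], of i v]
    by (simp add: plus_fun_def times_fun_def partial_def)
qed

lemma partial_power2 [simp]: "pdiff p \<Longrightarrow> partial i (p\<^sup>2) = 2 * p * partial i p"
  by (simp add: power2_eq_square algebra_simps)

subsection \<open>Curl and divergence\<close>

text \<open>Taking a component is bounded linear and so commutes with the derivative of
  \<open>F\<close>.\<close>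

lemma jacobian_nth:
  assumes "pdiff F"
  shows "jacobian F (at v) $ i $ j = partial j (\<lambda>v. F v $ i) v"
proof -
  have "((\<lambda>v. F v $ i) has_derivative (\<lambda>h. frechet_derivative F (at v) h $ i)) (at v)"
    by (rule bounded_linear.has_derivative[OF bounded_linear_vec_nth pdiff_has_derivative[OF assms]])
  from has_derivative_partial[OF this] show ?thesis
    by (simp add: jacobian_def matrix_def)
qed

lemma pdiff_component: "pdiff F \<Longrightarrow> pdiff (\<lambda>v. F v $ i :: real)"
  unfolding pdiff_def differentiable_def
  by (blast intro: bounded_linear.has_derivative[OF bounded_linear_vec_nth])

lemma vec_field_nth [simp]:
  "vec_field p q r v $ 1 = p v" "vec_field p q r v $ 2 = q v" "vec_field p q r v $ 3 = r v"
  by (simp_all add: vec_field_def)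

lemma pdiff_vec_field [simp]:
  assumes "pdiff p" "pdiff q" "pdiff r"
  shows "pdiff (vec_field p q r)"
proof -
  have "vec_field p q r differentiable at v" for v
  proof -
    have "(\<lambda>w. vec_field p q r w \<bullet> i) differentiable at v" if "i \<in> Basis" for i
    proof -
      \<comment> \<open>The basis vectors of \<open>real ^ 3\<close> are the axis vectors, so the
        inner product with one of them is a coordinate.\<close>
      have "\<exists>k :: 3. i = axis k 1" using that by (simp add: Basis_vec_def)
      then obtain k :: 3 where k: "i = axis k 1" ..
      have "(\<lambda>w. vec_field p q r w $ k) differentiable at v"
        using assms exhaust_3[of k] by (auto simp: pdiff_def)
      then show ?thesis by (simp add: k inner_axis)
    qed
    then show ?thesis using differentiable_componentwise_within[of _ v UNIV] by auto
  qed
  then show ?thesis by (simp add: pdiff_def)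
qed

lemma curl_eq:
  "pdiff F \<Longrightarrow> curl F = vec_field
     (partial 2 (\<lambda>v. F v $ 3) - partial 3 (\<lambda>v. F v $ 2))
     (partial 3 (\<lambda>v. F v $ 1) - partial 1 (\<lambda>v. F v $ 3))
     (partial 1 (\<lambda>v. F v $ 2) - partial 2 (\<lambda>v. F v $ 1))"
  by (simp add: curl_def vec_field_def fun_eq_iff jacobian_nth)

lemma divergence_eq:
  "pdiff F \<Longrightarrow> divergence F =
     partial 1 (\<lambda>v. F v $ 1) + partial 2 (\<lambda>v. F v $ 2) + partial 3 (\<lambda>v. F v $ 3)"
  by (simp add: divergence_def fun_eq_iff jacobian_nth)

lemma curl_vec_field [simp]:
  "pdiff p \<Longrightarrow> pdiff q \<Longrightarrow> pdiff r \<Longrightarrow> curl (vec_field p q r) =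
     vec_field (partial 2 r - partial 3 q) (partial 3 p - partial 1 r) (partial 1 q - partial 2 p)"
  by (simp add: curl_eq)

lemma divergence_vec_field [simp]:
  "pdiff p \<Longrightarrow> pdiff q \<Longrightarrow> pdiff r \<Longrightarrow>
     divergence (vec_field p q r) = partial 1 p + partial 2 q + partial 3 r"
  by (simp add: divergence_eq)

section \<open>Linearity of curl and divergence\<close>

lemma component_add: "(\<lambda>v. (F + G) v $ i) = (\<lambda>v. F v $ i) + (\<lambda>v. G v $ i)"
  and component_scaleR: "(\<lambda>v. (c *\<^sub>R F) v $ i) = c *\<^sub>R (\<lambda>v. F v $ i)"
  for F G :: vector_field
  by (simp_all add: fun_eq_iff scaleR_fun_def)

lemma vec_field_eq_iff: "F = vec_field p q r \<longleftrightarrow> (\<forall>v. F v $ 1 = p v \<and> F v $ 2 = q v \<and> F v $ 3 = r v)"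
  by (auto simp: fun_eq_iff vec_eq_iff forall_3)

lemma vec_field_zero [simp]: "vec_field 0 0 0 = 0"
  by (rule sym) (simp add: vec_field_eq_iff)

lemma vec_field_add: "vec_field p q r + vec_field p' q' r' = vec_field (p + p') (q + q') (r + r')"
  by (simp add: vec_field_eq_iff)

lemma vec_field_scaleR: "c *\<^sub>R vec_field p q r = vec_field (c *\<^sub>R p) (c *\<^sub>R q) (c *\<^sub>R r)"
  by (simp add: vec_field_eq_iff scaleR_fun_def)

lemma curl_add: "pdiff F \<Longrightarrow> pdiff G \<Longrightarrow> curl (F + G) = curl F + curl G"
  \<comment> \<open>\<open>plus_fun_apply\<close> would evaluate the sum at \<open>v\<close> before
    \<open>component_add\<close> could produce the sum of functions that \<open>partial_add\<close>
    needs.\<close>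
  by (simp add: curl_eq component_add pdiff_component vec_field_add algebra_simps
      del: plus_fun_apply)

lemma curl_scaleR: "pdiff F \<Longrightarrow> curl (c *\<^sub>R F) = c *\<^sub>R curl F"
  by (simp add: curl_eq component_scaleR pdiff_component vec_field_scaleR scaleR_diff_right)

lemma divergence_add: "pdiff F \<Longrightarrow> pdiff G \<Longrightarrow> divergence (F + G) = divergence F + divergence G"
  by (simp add: divergence_eq component_add pdiff_component del: plus_fun_apply)

lemma divergence_scaleR: "pdiff F \<Longrightarrow> divergence (c *\<^sub>R F) = c *\<^sub>R divergence F"
  by (simp add: divergence_eq component_scaleR pdiff_component scaleR_add_right)

lemma curl_zero: "curl 0 = 0"
  using curl_vec_field[of 0 0 0] by simp

lemma divergence_zero: "divergence 0 = 0"
  using divergence_vec_field[of 0 0 0] by simp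

subsection \<open>The cross product with the position vector\<close>

text \<open>The field under the curl in \<open>ERT0\<close>, as a map between vector fields, so that
  its linearity can be used on spans.\<close>

definition pos_cross :: "vector_field \<Rightarrow> vector_field" where
  "pos_cross F = (\<lambda>v. cross3 v (F v))"

lemma pos_cross_vec_field:
  "pos_cross (vec_field p q r) = vec_field (Y * r - Z * q) (Z * p - X * r) (X * q - Y * p)"
  by (simp add: vec_field_eq_iff pos_cross_def cross3_def X_def Y_def Z_def)

lemma pos_cross_add: "pos_cross (F + G) = pos_cross F + pos_cross G"
  and pos_cross_scaleR: "pos_cross (c *\<^sub>R F) = c *\<^sub>R pos_cross F"
  and pos_cross_zero: "pos_cross 0 = 0"
  by (simp_all add: fun_eq_iff pos_cross_def scaleR_fun_def cross_add_right cross_mult_right)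

lemma linear_pos_cross: "linear pos_cross"
  by (simp add: linear_iff pos_cross_add pos_cross_scaleR)

subsection \<open>Membership in the finite element spaces\<close>

lemma Theta_span:
  "u \<in> Theta \<Longrightarrow> v \<in> Theta \<Longrightarrow> u + v \<in> Theta" "u \<in> Theta \<Longrightarrow> c *\<^sub>R u \<in> Theta" "0 \<in> Theta"
  unfolding Theta_def by (auto intro: span_add span_scale span_zero)

lemma vec_field_in_ThetaI:
  assumes "vec_field p 0 0 \<in> Theta" "vec_field 0 q 0 \<in> Theta" "vec_field 0 0 r \<in> Theta"
  shows "vec_field p q r \<in> Theta"
  using Theta_span(1)[OF Theta_span(1)[OF assms(1,2)] assms(3)] by (simp add: vec_field_add)

lemma vec_field_minus: "- vec_field p q r = vec_field (- p) (- q) (- r)"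
  by (simp add: vec_field_eq_iff)

text \<open>Cross products with the position vector produce monomials of either sign, while the
  single-component generators of \<open>Theta\<close> carry no sign.\<close>

lemma Theta_minus_iff: "vec_field (- p) (- q) (- r) \<in> Theta \<longleftrightarrow> vec_field p q r \<in> Theta"
  using Theta_span(2)[of "vec_field p q r" "-1"] Theta_span(2)[of "- vec_field p q r" "-1"]
  by (auto simp: vec_field_minus)

lemmas Theta_minus_simps = Theta_minus_iff[of _ 0 0, simplified] Theta_minus_iff[of 0 _ 0, simplified]
  Theta_minus_iff[of 0 0, simplified]

lemma monomials_in_Theta:
  "p \<in> {1, X, Y, Z, X * Y, X * Z, Y * Z, X * Y * Z, Y^2, Z^2, X * Y^2, X * Z^2, Y^2 * Z, Y * Z^2}
    \<Longrightarrow> vec_field p 0 0 \<in> Theta"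
  "p \<in> {1, X, Y, Z, X * Y, X * Z, Y * Z, X * Y * Z, X^2, Z^2, X^2 * Y, Y * Z^2, X^2 * Z, X * Z^2}
    \<Longrightarrow> vec_field 0 p 0 \<in> Theta"
  "p \<in> {1, X, Y, Z, X * Y, X * Z, Y * Z, X * Y * Z, X^2, Y^2, X^2 * Z, Y^2 * Z, X^2 * Y, X * Y^2}
    \<Longrightarrow> vec_field 0 0 p \<in> Theta"
  unfolding Theta_def by (rule span_base, blast)+

text \<open>The mixed generators of \<open>Theta\<close> with a zero entry are exactly these three
  fields. Their entries have degree four, above that of every single-component generator.\<close>

lemma pos_cross_XYZ_in_Theta:
  "pos_cross (vec_field (X * Y * Z) 0 0) \<in> Theta"
  "pos_cross (vec_field 0 (X * Y * Z) 0) \<in> Theta"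
  "pos_cross (vec_field 0 0 (X * Y * Z)) \<in> Theta"
proof -
  have "vec_field 0 (X * Y * Z^2) (- (X * Y^2 * Z)) \<in> Theta"
    "vec_field (- (X * Y * Z^2)) 0 (X^2 * Y * Z) \<in> Theta"
    "vec_field (X * Y^2 * Z) (- (X^2 * Y * Z)) 0 \<in> Theta"
    unfolding Theta_def by (rule span_base, blast)+
  then show "pos_cross (vec_field (X * Y * Z) 0 0) \<in> Theta"
    "pos_cross (vec_field 0 (X * Y * Z) 0) \<in> Theta"
    "pos_cross (vec_field 0 0 (X * Y * Z)) \<in> Theta"
    using Theta_minus_iff
    by (simp_all add: pos_cross_vec_field power2_eq_square mult_ac)
qed

text \<open>Each entry of the cross product is zero or, up to sign, a monomial listed for that
  component in \<open>Theta\<close>, so the components can be treated separately.\<close>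

lemma pos_cross_monomial_in_Theta:
  "b \<in> {Y, Z, X * Y, X * Z, Y * Z} \<Longrightarrow> pos_cross (vec_field b 0 0) \<in> Theta"
  "b \<in> {X, Z, X * Y, X * Z, Y * Z} \<Longrightarrow> pos_cross (vec_field 0 b 0) \<in> Theta"
  "b \<in> {X, Y, X * Y, X * Z, Y * Z} \<Longrightarrow> pos_cross (vec_field 0 0 b) \<in> Theta"
  unfolding pos_cross_vec_field
  by (rule vec_field_in_ThetaI; elim insertE;
      simp add: monomials_in_Theta Theta_minus_simps power2_eq_square mult_ac Theta_span(3))+

text \<open>A linear map sends a span to the span of the image, and \<open>Theta\<close> is its own
  span, so the generators of \<open>B_space\<close> suffice.\<close>

lemma pos_cross_B_space_subset_Theta: "pos_cross ` B_space \<subseteq> Theta"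
proof -
  have "pos_cross ` B_space \<subseteq> span Theta"
    unfolding B_space_def linear_span_image[OF linear_pos_cross, symmetric]
    by (rule span_mono) (use pos_cross_monomial_in_Theta pos_cross_XYZ_in_Theta in auto)
  also have "span Theta = Theta"
    by (simp add: Theta_def span_span)
  finally show ?thesis .
qed

lemma curl_Theta_solenoidal:
  assumes "F \<in> Theta"
  shows "pdiff F" "pdiff (curl F)" "divergence (curl F) = 0"
proof -
  \<comment> \<open>Differentiability is part of the subspace because \<open>curl_add\<close> asks
    for it of \<open>F\<close> and \<open>divergence_add\<close> of \<open>curl F\<close>.\<close>
  have "subspace {F. pdiff F \<and> pdiff (curl F) \<and> divergence (curl F) = 0}"
    by (simp add: subspace_def curl_zero divergence_zero curl_add curl_scaleR divergence_add
        divergence_scaleR)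
  then have "Theta \<subseteq> {F. pdiff F \<and> pdiff (curl F) \<and> divergence (curl F) = 0}"
    unfolding Theta_def
    by (intro span_minimal) (simp_all add: divergence_zero)
  then show "pdiff F" "pdiff (curl F)" "divergence (curl F) = 0"
    using assms by auto
qed

section \<open>The space RT0 and potentials of its divergence-free fields\<close>

lemma RT0_iff: "F \<in> RT0 \<longleftrightarrow> (\<exists>a b c k l m. F = vec_field
    (a *\<^sub>R 1 + k *\<^sub>R X) (b *\<^sub>R 1 + l *\<^sub>R Y) (c *\<^sub>R 1 + m *\<^sub>R Z))"
proof -
  have "(\<lambda>v. vector [a + k * v $ 1, b + l * v $ 2, c + m * v $ 3]) = vec_field
    (a *\<^sub>R 1 + k *\<^sub>R X) (b *\<^sub>R 1 + l *\<^sub>R Y) (c *\<^sub>R 1 + m *\<^sub>R Z)" for a b c k l m :: real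
    by (simp add: vec_field_def fun_eq_iff scaleR_fun_def X_def Y_def Z_def)
  then show ?thesis by (simp add: RT0_def)
qed

lemma subspace_RT0: "subspace RT0"
proof (rule subspaceI)
  show "0 \<in> RT0"
    unfolding RT0_iff by (intro exI[of _ 0]) simp
  show "F + G \<in> RT0" if "F \<in> RT0" "G \<in> RT0" for F G
  proof -
    from that obtain a b c k l m a' b' c' k' l' m' where
      "F = vec_field (a *\<^sub>R 1 + k *\<^sub>R X) (b *\<^sub>R 1 + l *\<^sub>R Y) (c *\<^sub>R 1 + m *\<^sub>R Z)"
      "G = vec_field (a' *\<^sub>R 1 + k' *\<^sub>R X) (b' *\<^sub>R 1 + l' *\<^sub>R Y) (c' *\<^sub>R 1 + m' *\<^sub>R Z)"
      unfolding RT0_iff by blast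
    then have "F + G = vec_field ((a + a') *\<^sub>R 1 + (k + k') *\<^sub>R X)
        ((b + b') *\<^sub>R 1 + (l + l') *\<^sub>R Y) ((c + c') *\<^sub>R 1 + (m + m') *\<^sub>R Z)"
      by (simp add: vec_field_add algebra_simps)
    then show ?thesis unfolding RT0_iff by blast
  qed
  show "d *\<^sub>R F \<in> RT0" if "F \<in> RT0" for d F
  proof -
    from that obtain a b c k l m where
      "F = vec_field (a *\<^sub>R 1 + k *\<^sub>R X) (b *\<^sub>R 1 + l *\<^sub>R Y) (c *\<^sub>R 1 + m *\<^sub>R Z)"
      unfolding RT0_iff by blast
    then have "d *\<^sub>R F = vec_field ((d * a) *\<^sub>R 1 + (d * k) *\<^sub>R X)
        ((d * b) *\<^sub>R 1 + (d * l) *\<^sub>R Y) ((d * c) *\<^sub>R 1 + (d * m) *\<^sub>R Z)"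
      by (simp add: vec_field_scaleR algebra_simps)
    then show ?thesis unfolding RT0_iff by blast
  qed
qed

lemma pdiff_RT0: "F \<in> RT0 \<Longrightarrow> pdiff F"
  by (auto simp: RT0_iff)

lemma solenoidal_RT0_potential:
  assumes "F \<in> RT0" "divergence F = 0"
  obtains G where "G \<in> Theta" "curl G = F"
proof -
  obtain a b c k l m where F:
    "F = vec_field (a *\<^sub>R 1 + k *\<^sub>R X) (b *\<^sub>R 1 + l *\<^sub>R Y) (c *\<^sub>R 1 + m *\<^sub>R Z)"
    using assms(1) unfolding RT0_iff by blast
  have "divergence F = (k + l + m) *\<^sub>R 1"
    by (simp add: F scaleR_add_left)
  then have m: "m = - k - l"
    using assms(2) by (simp add: fun_eq_iff scaleR_fun_def)
  \<comment> \<open>The first three terms have curls (0, b, 0), (0, 0, c) and (a, 0, 0). The last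
    two have curls (0, l y, -l z) and (k x, 0, -k z), which add up to the linear part of
    \<open>F\<close> since \<open>m = - k - l\<close>.\<close>
  define G where "G = b *\<^sub>R vec_field Z 0 0 + c *\<^sub>R vec_field 0 X 0 + a *\<^sub>R vec_field 0 0 Y
     + l *\<^sub>R vec_field (Y * Z) 0 0 + (- k) *\<^sub>R vec_field 0 (X * Z) 0"
  have "G \<in> Theta"
    unfolding G_def by (intro Theta_span monomials_in_Theta) auto
  moreover have "curl G = F"
    by (simp add: G_def F m vec_field_add vec_field_scaleR algebra_simps)
  ultimately show ?thesis using that by blast
qed

section \<open>ERT0 as a vector space\<close>

lemma ERT0_iff: "F \<in> ERT0 \<longleftrightarrow> (\<exists>r b. F = r + curl (pos_cross b) \<and> r \<in> RT0 \<and> b \<in> B_space)"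
  by (auto simp: ERT0_def pos_cross_def)

text \<open>The rules for \<open>curl\<close> ask for differentiable fields, and
  \<open>pos_cross b\<close> is one because it lies in \<open>Theta\<close>.\<close>

lemma curl_pos_cross_linear:
  assumes "b \<in> B_space"
  shows "b' \<in> B_space \<Longrightarrow> curl (pos_cross (b + b')) = curl (pos_cross b) + curl (pos_cross b')"
    and "curl (pos_cross (c *\<^sub>R b)) = c *\<^sub>R curl (pos_cross b)"
proof -
  have *: "pdiff (pos_cross d)" if "d \<in> B_space" for d
    using that pos_cross_B_space_subset_Theta curl_Theta_solenoidal(1) by blast
  show "b' \<in> B_space \<Longrightarrow> curl (pos_cross (b + b')) = curl (pos_cross b) + curl (pos_cross b')"
    using assms by (simp add: pos_cross_add curl_add *)
  show "curl (pos_cross (c *\<^sub>R b)) = c *\<^sub>R curl (pos_cross b)"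
    using assms by (simp add: pos_cross_scaleR curl_scaleR *)
qed

lemma B_space_span:
  "u \<in> B_space \<Longrightarrow> v \<in> B_space \<Longrightarrow> u + v \<in> B_space"
  "u \<in> B_space \<Longrightarrow> c *\<^sub>R u \<in> B_space" "0 \<in> B_space"
  unfolding B_space_def by (auto intro: span_add span_scale span_zero)

lemma subspace_ERT0: "subspace ERT0"
proof (rule subspaceI)
  show "0 \<in> ERT0"
    unfolding ERT0_iff using subspace_0[OF subspace_RT0] B_space_span(3)
    by (intro exI[of _ 0]) (simp add: pos_cross_zero curl_zero)
  show "F + G \<in> ERT0" if "F \<in> ERT0" "G \<in> ERT0" for F G
  proof -
    from that obtain r b r' b' where
      F: "F = r + curl (pos_cross b)" "r \<in> RT0" "b \<in> B_space" and
      G: "G = r' + curl (pos_cross b')" "r' \<in> RT0" "b' \<in> B_space"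
      unfolding ERT0_iff by blast
    then have "F + G = (r + r') + curl (pos_cross (b + b'))"
      by (simp add: curl_pos_cross_linear)
    then show ?thesis
      unfolding ERT0_iff using F G B_space_span(1) subspace_add[OF subspace_RT0] by blast
  qed
  show "d *\<^sub>R F \<in> ERT0" if "F \<in> ERT0" for d F
  proof -
    from that obtain r b where
      F: "F = r + curl (pos_cross b)" "r \<in> RT0" "b \<in> B_space"
      unfolding ERT0_iff by blast
    then have "d *\<^sub>R F = d *\<^sub>R r + curl (pos_cross (d *\<^sub>R b))"
      by (simp add: curl_pos_cross_linear scaleR_add_right)
    then show ?thesis
      unfolding ERT0_iff using F B_space_span(2) subspace_scale[OF subspace_RT0] by blast
  qed
qed

lemma RT0_subset_ERT0: "RT0 \<subseteq> ERT0"
proof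
  fix r assume "r \<in> RT0"
  moreover have "r = r + curl (pos_cross 0)" by (simp add: pos_cross_zero curl_zero)
  ultimately show "r \<in> ERT0" unfolding ERT0_iff using B_space_span(3) by blast
qed

lemma curl_pos_cross_in_ERT0:
  assumes "b \<in> B_space"
  shows "curl (pos_cross b) \<in> ERT0"
proof -
  have "curl (pos_cross b) = 0 + curl (pos_cross b)" by simp
  then show ?thesis unfolding ERT0_iff using assms subspace_0[OF subspace_RT0] by blast
qed

subsection \<open>Curls of the generators\<close>

text \<open>Two terms cover every single-component monomial field needed below. Where one is enough,
  the second coefficient and field are set to 0.\<close>

lemma ERT0I:
  assumes "F = c *\<^sub>R curl (pos_cross b) + d *\<^sub>R curl (pos_cross b')"
    and "b \<in> B_space" "b' \<in> B_space"
  shows "F \<in> ERT0"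
  unfolding assms(1) using assms(2,3)
  by (intro subspace_add subspace_scale subspace_ERT0 curl_pos_cross_in_ERT0)

lemma vec_field_in_RT0:
  "vec_field (a *\<^sub>R 1 + k *\<^sub>R X) (b *\<^sub>R 1 + l *\<^sub>R Y) (c *\<^sub>R 1 + m *\<^sub>R Z) \<in> RT0"
  unfolding RT0_iff by blast

lemma monomials_in_B_space:
  "b \<in> {Y, Z, X * Y, X * Z, Y * Z, X * Y * Z} \<Longrightarrow> vec_field b 0 0 \<in> B_space"
  "b \<in> {X, Z, X * Y, X * Z, Y * Z, X * Y * Z} \<Longrightarrow> vec_field 0 b 0 \<in> B_space"
  "b \<in> {X, Y, X * Y, X * Z, Y * Z, X * Y * Z} \<Longrightarrow> vec_field 0 0 b \<in> B_space"
  unfolding B_space_def by (rule span_base, blast)+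

text \<open>Splits an equation between fields into three polynomial identities, which are then
  verified with \<open>pointwise\<close>.\<close>

lemma vec_field_cong:
  "p = p' \<Longrightarrow> q = q' \<Longrightarrow> r = r' \<Longrightarrow> vec_field p q r = vec_field p' q' r'"
  by simp

lemmas vec_field_ops = pos_cross_vec_field vec_field_add vec_field_scaleR

lemmas combination_simps = monomials_in_B_space B_space_span(3) vec_field_ops pos_cross_zero curl_zero

lemmas pointwise = fun_eq_iff scaleR_fun_def power2_eq_square algebra_simps

text \<open>If \<open>w\<close> is divergence-free and homogeneous of degree \<open>k\<close> then \<open>curl (x \<times> w) = - (k + 2) w\<close>. The
  coefficients below come from \<open>b = - (w + f x) / (k + 2)\<close>, where \<open>w\<close> is the curl of the monomial
  field and the scalar field \<open>f\<close>, which does not change \<open>x \<times> b\<close>, is chosen to make \<open>b\<close> lie in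
  \<open>B_space\<close>.\<close>

lemma curl_first_component_in_ERT0:
  "curl (vec_field (X * Y) 0 0) \<in> ERT0"
  "curl (vec_field (X * Z) 0 0) \<in> ERT0"
  "curl (vec_field (X * Y * Z) 0 0) \<in> ERT0"
  "curl (vec_field (Y^2) 0 0) \<in> ERT0"
  "curl (vec_field (Z^2) 0 0) \<in> ERT0"
  "curl (vec_field (X * Y^2) 0 0) \<in> ERT0"
  "curl (vec_field (X * Z^2) 0 0) \<in> ERT0"
  "curl (vec_field (Y^2 * Z) 0 0) \<in> ERT0"
  "curl (vec_field (Y * Z^2) 0 0) \<in> ERT0"
  subgoal by (rule ERT0I[of _ "1/3" "vec_field 0 0 X" 0 0];
      (simp add: combination_simps)?; (rule vec_field_cong; simp add: pointwise)?)
  subgoal by (rule ERT0I[of _ "-1/3" "vec_field 0 X 0" 0 0];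
      (simp add: combination_simps)?; (rule vec_field_cong; simp add: pointwise)?)
  subgoal by (rule ERT0I[of _ "1/4" "vec_field 0 0 (X * Z)" "-1/4" "vec_field 0 (X * Y) 0"];
      (simp add: combination_simps)?; (rule vec_field_cong; simp add: pointwise)?)
  subgoal by (rule ERT0I[of _ "2/3" "vec_field 0 0 Y" 0 0];
      (simp add: combination_simps)?; (rule vec_field_cong; simp add: pointwise)?)
  subgoal by (rule ERT0I[of _ "-2/3" "vec_field 0 Z 0" 0 0];
      (simp add: combination_simps)?; (rule vec_field_cong; simp add: pointwise)?)
  subgoal by (rule ERT0I[of _ "1/2" "vec_field 0 0 (X * Y)" 0 0];
      (simp add: combination_simps)?; (rule vec_field_cong; simp add: pointwise)?)
  subgoal by (rule ERT0I[of _ "-1/2" "vec_field 0 (X * Z) 0" 0 0];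
      (simp add: combination_simps)?; (rule vec_field_cong; simp add: pointwise)?)
  \<comment> \<open>Here w = (0, y^2, -2 y z), and f = -y cancels the entry y^2, which does not
    occur in \<open>B_space\<close>. The next case takes f = z, and all earlier ones f = 0.\<close>
  subgoal by (rule ERT0I[of _ "1/4" "vec_field (X * Y) 0 0" "3/4" "vec_field 0 0 (Y * Z)"];
      (simp add: combination_simps)?; (rule vec_field_cong; simp add: pointwise)?)
  subgoal by (rule ERT0I[of _ "-1/4" "vec_field (X * Z) 0 0" "-3/4" "vec_field 0 (Y * Z) 0"];
      (simp add: combination_simps)?; (rule vec_field_cong; simp add: pointwise)?)
  done

text \<open>The cyclic shift x to y to z to x, applied also to the components, carries the preceding
  list to this one. It preserves orientation, so the coefficients are unchanged.\<close>

lemma curl_second_component_in_ERT0: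
  "curl (vec_field 0 (Y * Z) 0) \<in> ERT0"
  "curl (vec_field 0 (X * Y) 0) \<in> ERT0"
  "curl (vec_field 0 (X * Y * Z) 0) \<in> ERT0"
  "curl (vec_field 0 (Z^2) 0) \<in> ERT0"
  "curl (vec_field 0 (X^2) 0) \<in> ERT0"
  "curl (vec_field 0 (Y * Z^2) 0) \<in> ERT0"
  "curl (vec_field 0 (X^2 * Y) 0) \<in> ERT0"
  "curl (vec_field 0 (X * Z^2) 0) \<in> ERT0"
  "curl (vec_field 0 (X^2 * Z) 0) \<in> ERT0"
  subgoal by (rule ERT0I[of _ "1/3" "vec_field Y 0 0" 0 0];
      (simp add: combination_simps)?; (rule vec_field_cong; simp add: pointwise)?)
  subgoal by (rule ERT0I[of _ "-1/3" "vec_field 0 0 Y" 0 0];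
      (simp add: combination_simps)?; (rule vec_field_cong; simp add: pointwise)?)
  subgoal by (rule ERT0I[of _ "1/4" "vec_field (X * Y) 0 0" "-1/4" "vec_field 0 0 (Y * Z)"];
      (simp add: combination_simps)?; (rule vec_field_cong; simp add: pointwise)?)
  subgoal by (rule ERT0I[of _ "2/3" "vec_field Z 0 0" 0 0];
      (simp add: combination_simps)?; (rule vec_field_cong; simp add: pointwise)?)
  subgoal by (rule ERT0I[of _ "-2/3" "vec_field 0 0 X" 0 0];
      (simp add: combination_simps)?; (rule vec_field_cong; simp add: pointwise)?)
  subgoal by (rule ERT0I[of _ "1/2" "vec_field (Y * Z) 0 0" 0 0];
      (simp add: combination_simps)?; (rule vec_field_cong; simp add: pointwise)?)
  subgoal by (rule ERT0I[of _ "-1/2" "vec_field 0 0 (X * Y)" 0 0];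
      (simp add: combination_simps)?; (rule vec_field_cong; simp add: pointwise)?)
  subgoal by (rule ERT0I[of _ "1/4" "vec_field 0 (Y * Z) 0" "3/4" "vec_field (X * Z) 0 0"];
      (simp add: combination_simps)?; (rule vec_field_cong; simp add: pointwise)?)
  subgoal by (rule ERT0I[of _ "-1/4" "vec_field 0 (X * Y) 0" "-3/4" "vec_field 0 0 (X * Z)"];
      (simp add: combination_simps)?; (rule vec_field_cong; simp add: pointwise)?)
  done

text \<open>The same cyclic shift once more.\<close>

lemma curl_third_component_in_ERT0:
  "curl (vec_field 0 0 (X * Z)) \<in> ERT0"
  "curl (vec_field 0 0 (Y * Z)) \<in> ERT0"
  "curl (vec_field 0 0 (X * Y * Z)) \<in> ERT0"
  "curl (vec_field 0 0 (X^2)) \<in> ERT0"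
  "curl (vec_field 0 0 (Y^2)) \<in> ERT0"
  "curl (vec_field 0 0 (X^2 * Z)) \<in> ERT0"
  "curl (vec_field 0 0 (Y^2 * Z)) \<in> ERT0"
  "curl (vec_field 0 0 (X^2 * Y)) \<in> ERT0"
  "curl (vec_field 0 0 (X * Y^2)) \<in> ERT0"
  subgoal by (rule ERT0I[of _ "1/3" "vec_field 0 Z 0" 0 0];
      (simp add: combination_simps)?; (rule vec_field_cong; simp add: pointwise)?)
  subgoal by (rule ERT0I[of _ "-1/3" "vec_field Z 0 0" 0 0];
      (simp add: combination_simps)?; (rule vec_field_cong; simp add: pointwise)?)
  subgoal by (rule ERT0I[of _ "1/4" "vec_field 0 (Y * Z) 0" "-1/4" "vec_field (X * Z) 0 0"];
      (simp add: combination_simps)?; (rule vec_field_cong; simp add: pointwise)?)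
  subgoal by (rule ERT0I[of _ "2/3" "vec_field 0 X 0" 0 0];
      (simp add: combination_simps)?; (rule vec_field_cong; simp add: pointwise)?)
  subgoal by (rule ERT0I[of _ "-2/3" "vec_field Y 0 0" 0 0];
      (simp add: combination_simps)?; (rule vec_field_cong; simp add: pointwise)?)
  subgoal by (rule ERT0I[of _ "1/2" "vec_field 0 (X * Z) 0" 0 0];
      (simp add: combination_simps)?; (rule vec_field_cong; simp add: pointwise)?)
  subgoal by (rule ERT0I[of _ "-1/2" "vec_field (Y * Z) 0 0" 0 0];
      (simp add: combination_simps)?; (rule vec_field_cong; simp add: pointwise)?)
  subgoal by (rule ERT0I[of _ "1/4" "vec_field 0 0 (X * Z)" "3/4" "vec_field 0 (X * Y) 0"];
      (simp add: combination_simps)?; (rule vec_field_cong; simp add: pointwise)?)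
  subgoal by (rule ERT0I[of _ "-1/4" "vec_field 0 0 (Y * Z)" "-3/4" "vec_field (X * Y) 0 0"];
      (simp add: combination_simps)?; (rule vec_field_cong; simp add: pointwise)?)
  done

text \<open>Fields of degree at most one have constant curl. For the product of the two other
  coordinates, each entry of the curl is zero or a multiple of its own coordinate, as in
  \<open>RT0\<close>.\<close>

lemma curl_monomials_in_RT0:
  "p \<in> {1, X, Y, Z, Y * Z} \<Longrightarrow> curl (vec_field p 0 0) \<in> RT0"
  "p \<in> {1, X, Y, Z, X * Z} \<Longrightarrow> curl (vec_field 0 p 0) \<in> RT0"
  "p \<in> {1, X, Y, Z, X * Y} \<Longrightarrow> curl (vec_field 0 0 p) \<in> RT0"
  \<comment> \<open>The arguments are constant and slope of each component in turn. The first six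
    instances are the signed unit vectors. The other three are (0, y, -z), (-x, 0, z) and (x, -y,
    0), the curls of the quadratic fields.\<close>
  using vec_field_in_RT0[of 1 0 0 0 0 0] vec_field_in_RT0[of "-1" 0 0 0 0 0]
    vec_field_in_RT0[of 0 0 1 0 0 0] vec_field_in_RT0[of 0 0 "-1" 0 0 0]
    vec_field_in_RT0[of 0 0 0 0 1 0] vec_field_in_RT0[of 0 0 0 0 "-1" 0]
    vec_field_in_RT0[of 0 0 0 1 0 "-1"] vec_field_in_RT0[of 0 "-1" 0 0 0 1]
    vec_field_in_RT0[of 0 1 0 "-1" 0 0] subspace_0[OF subspace_RT0]
  by (elim insertE; simp)+

text \<open>The fields are the gradients of x^2 y^2 z, x^2 y z^2 and x y^2 z^2.\<close>

lemma curl_gradient: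
  "curl (vec_field (2 * X * Y^2 * Z) (2 * X^2 * Y * Z) (X^2 * Y^2)) = 0"
  "curl (vec_field (2 * X * Y * Z^2) (X^2 * Z^2) (2 * X^2 * Y * Z)) = 0"
  "curl (vec_field (Y^2 * Z^2) (2 * X * Y * Z^2) (2 * X * Y^2 * Z)) = 0"
  by simp_all

lemma curl_Theta_subset_ERT0: "curl ` Theta \<subseteq> ERT0"
proof -
  have "subspace {F. pdiff F \<and> curl F \<in> ERT0}"
    using subspace_ERT0 by (simp add: subspace_def curl_zero curl_add curl_scaleR)
  \<comment> \<open>These generators have the form \<open>pos_cross b\<close> with \<open>b\<close>
    in \<open>B_space\<close>, so their curls are in \<open>ERT0\<close> by its definition.\<close>
  moreover have "pos_cross (vec_field (X * Y * Z) 0 0) = vec_field 0 (X * Y * Z^2) (- (X * Y^2 * Z))"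
    "pos_cross (vec_field 0 (X * Y * Z) 0) = vec_field (- (X * Y * Z^2)) 0 (X^2 * Y * Z)"
    "pos_cross (vec_field 0 0 (X * Y * Z)) = vec_field (X * Y^2 * Z) (- (X^2 * Y * Z)) 0"
    by (simp_all add: pos_cross_vec_field power2_eq_square mult_ac)
  then have "curl (vec_field 0 (X * Y * Z^2) (- (X * Y^2 * Z))) \<in> ERT0"
    "curl (vec_field (- (X * Y * Z^2)) 0 (X^2 * Y * Z)) \<in> ERT0"
    "curl (vec_field (X * Y^2 * Z) (- (X^2 * Y * Z)) 0) \<in> ERT0"
    using monomials_in_B_space[of "X * Y * Z"] curl_pos_cross_in_ERT0 by fastforce+
  ultimately have "Theta \<subseteq> {F. pdiff F \<and> curl F \<in> ERT0}"
    unfolding Theta_def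
    \<comment> \<open>The curls stay unevaluated so that the membership facts match them.\<close>
    by (intro span_minimal) (simp_all del: curl_vec_field add: curl_gradient
        subspace_0[OF subspace_ERT0] subsetD[OF RT0_subset_ERT0 curl_monomials_in_RT0(1)]
        subsetD[OF RT0_subset_ERT0 curl_monomials_in_RT0(2)]
        subsetD[OF RT0_subset_ERT0 curl_monomials_in_RT0(3)]
        curl_first_component_in_ERT0 curl_second_component_in_ERT0 curl_third_component_in_ERT0)
  then show ?thesis by blast
qed

theorem mainTheorem7:
  shows "curl ` Theta = {p \<in> ERT0. \<forall>v. divergence p v = 0}"
proof (intro equalityI subsetI)
  fix p assume "p \<in> curl ` Theta"
  then show "p \<in> {p \<in> ERT0. \<forall>v. divergence p v = 0}"
    using curl_Theta_subset_ERT0 curl_Theta_solenoidal(3) by auto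
next
  fix p assume "p \<in> {p \<in> ERT0. \<forall>v. divergence p v = 0}"
  then obtain r b where p: "p = r + curl (pos_cross b)" and r: "r \<in> RT0" and b: "b \<in> B_space"
    and "divergence p = 0"
    unfolding ERT0_iff by (auto simp: fun_eq_iff)
  have T: "pos_cross b \<in> Theta"
    using b pos_cross_B_space_subset_Theta by blast
  \<comment> \<open>The summand \<open>curl (pos_cross b)\<close> is divergence-free by itself, so
    the \<open>RT0\<close> part must be as well and has its own potential.\<close>
  then have "divergence r = 0"
    using \<open>divergence p = 0\<close> r curl_Theta_solenoidal[OF T]
    by (simp add: p divergence_add pdiff_RT0)
  then obtain G where G: "G \<in> Theta" "curl G = r"
    using solenoidal_RT0_potential r by blast
  have "curl (G + pos_cross b) = p"
    using G T by (simp add: curl_add curl_Theta_solenoidal p)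
  then show "p \<in> curl ` Theta"
    using Theta_span(1)[OF G(1) T] by blast
qed

end
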